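(* Let $s$ be a positive integer and let $G$ be a graph on $n\ge 28s^2$ vertices with $\lambda(G)\ge \lambda(T_{n,2})$ and $\tau_3(G)\ge s$. Then $G$ contains at least $\frac{1}{2}sn-5s^2$ triangles.
   Context: All graphs are finite, simple and undirected. $\lambda(G)$ denotes the spectral radius of $G$, i.e. the largest eigenvalue of its adjacency matrix. $T_{n,2}$ is the bipartite Turán graph, i.e. the complete bipartite graph on $n$ vertices with parts of sizes $\lceil n/2\rceil$ and $\lfloor n/2\rfloor$. The triangle covering number $\tau_3(G)$ is the minimum number of vertices in a set that contains at least one vertex of each triangle of $G$. *)

theory Defs
  imports
    Complex_Main
    "Graph_Theory.Kuratowski"
    "Jordan_Normal_Form.Spectral_Radius"
begin

text \<open>
  A finite simple undirected graph is a term \<open>G :: 'a pair_pre_digraph\<close> with \<^term>\<open>pair_graph G\<close>: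
  a finite vertex set with a symmetric and irreflexive adjacency relation \<^term>\<open>parcs G\<close>.
  Each undirected edge is thus represented by its two orientations.
\<close>

definition adjacency_matrix :: "'a list \<Rightarrow> 'a pair_pre_digraph \<Rightarrow> real mat" where
  "adjacency_matrix vs G =
     mat (length vs) (length vs) (\<lambda>(i, j). if (vs ! i, vs ! j) \<in> parcs G then 1 else 0)"

definition vertex_enum :: "'a pair_pre_digraph \<Rightarrow> 'a list" where
  "vertex_enum G = (SOME vs. distinct vs \<and> set vs = pverts G)"

text \<open>
  The matrix depends on the arbitrary enumeration of the vertices; its spectrum does not, by
  \<open>eigenvalue_adjacency_matrix_iff\<close> below. As the matrix is real, its \<^const>\<open>spectrum\<close> is the
  set of its real eigenvalues.
\<close>

definition graph_spectral_radius :: "'a pair_pre_digraph \<Rightarrow> real" where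
  "graph_spectral_radius G = Max (spectrum (adjacency_matrix (vertex_enum G) G))"

definition complete_bipartite_on :: "'a set \<Rightarrow> 'a set \<Rightarrow> 'a pair_pre_digraph" where
  "complete_bipartite_on U V = \<lparr> pverts = U \<union> V, parcs = U \<times> V \<union> V \<times> U \<rparr>"

definition bipartite_turan :: "nat \<Rightarrow> nat pair_pre_digraph" where
  "bipartite_turan n = (let k = nat \<lceil>real n / 2\<rceil> in complete_bipartite_on {0..<k} {k..<n})"

definition triangles :: "'a pair_pre_digraph \<Rightarrow> 'a set set" where
  "triangles G =
     {{u, v, w} | u v w. (u, v) \<in> parcs G \<and> (v, w) \<in> parcs G \<and> (u, w) \<in> parcs G}"

definition triangle_covering_number :: "'a pair_pre_digraph \<Rightarrow> nat" where
  "triangle_covering_number G =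
     Min (card ` {S. S \<subseteq> pverts G \<and> (\<forall>T \<in> triangles G. S \<inter> T \<noteq> {})})"

lemma vertex_enum:
  assumes "finite (pverts G)"
  shows "distinct (vertex_enum G)" "set (vertex_enum G) = pverts G"
proof -
  have "\<exists>vs. distinct vs \<and> set vs = pverts G"
    using finite_distinct_list[OF assms] by blast
  from someI_ex[OF this] show "distinct (vertex_enum G)" "set (vertex_enum G) = pverts G"
    by (simp_all add: vertex_enum_def)
qed

lemma adjacency_matrix_mult_vec:
  assumes "distinct vs" "set vs = pverts G" "i < length vs"
  shows "(adjacency_matrix vs G *\<^sub>v vec (length vs) (\<lambda>j. x (vs ! j))) $ i =
         (\<Sum>w \<in> {w \<in> pverts G. (vs ! i, w) \<in> parcs G}. x w)"
proof -
  have "(adjacency_matrix vs G *\<^sub>v vec (length vs) (\<lambda>j. x (vs ! j))) $ i =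
        (\<Sum>j<length vs. if (vs ! i, vs ! j) \<in> parcs G then x (vs ! j) else 0)"
    using assms(3)
    by (auto simp: adjacency_matrix_def scalar_prod_def lessThan_atLeast0 intro!: sum.cong)
  also have "\<dots> = (\<Sum>w \<in> pverts G. if (vs ! i, w) \<in> parcs G then x w else 0)"
    using bij_betw_nth[OF assms(1) refl assms(2)[symmetric]]
    by (rule sum.reindex_bij_betw)
  also have "\<dots> = (\<Sum>w \<in> {w \<in> pverts G. (vs ! i, w) \<in> parcs G}. x w)"
    by (intro sum.inter_filter[symmetric]) (metis List.finite_set assms(2))
  finally show ?thesis .
qed

lemma eigenvalue_adjacency_matrix_iff:
  assumes "distinct vs" "set vs = pverts G"
  shows "eigenvalue (adjacency_matrix vs G) k \<longleftrightarrow>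
    (\<exists>x. (\<exists>v \<in> pverts G. x v \<noteq> 0) \<and>
         (\<forall>v \<in> pverts G. (\<Sum>w \<in> {w \<in> pverts G. (v, w) \<in> parcs G}. x w) = k * x v))"
    (is "?L \<longleftrightarrow> ?R")
proof
  let ?n = "length vs"
  have dim: "dim_row (adjacency_matrix vs G) = ?n"
    by (simp add: adjacency_matrix_def)
  {
    assume ?L
    then obtain y where y: "y \<in> carrier_vec ?n" "y \<noteq> 0\<^sub>v ?n"
      "adjacency_matrix vs G *\<^sub>v y = k \<cdot>\<^sub>v y"
      by (auto simp: eigenvalue_def eigenvector_def dim)
    define x where "x v = y $ (THE j. j < ?n \<and> vs ! j = v)" for v
    have x: "x (vs ! j) = y $ j" if "j < ?n" for j
    proof -
      have "(THE j'. j' < ?n \<and> vs ! j' = vs ! j) = j"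
        using that assms(1) by (intro the_equality) (auto simp: nth_eq_iff_index_eq)
      then show ?thesis by (simp add: x_def)
    qed
    have yx: "y = vec ?n (\<lambda>j. x (vs ! j))"
      using y(1) by (intro eq_vecI) (auto simp: x)
    from y(1,2) obtain j where j: "j < ?n" "y $ j \<noteq> 0"
      by (metis carrier_vecD eq_vecI index_zero_vec(1) index_zero_vec(2))
    have "\<exists>v \<in> pverts G. x v \<noteq> 0"
      using j x assms(2) nth_mem by metis
    moreover have "(\<Sum>w \<in> {w \<in> pverts G. (v, w) \<in> parcs G}. x w) = k * x v"
      if "v \<in> pverts G" for v
    proof -
      from that assms(2) obtain i where i: "i < ?n" "vs ! i = v"
        by (metis in_set_conv_nth)
      have "(adjacency_matrix vs G *\<^sub>v y) $ i = k * x v"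
        using i y(1) x[OF i(1)] by (simp add: y(3))
      then show ?thesis
        using adjacency_matrix_mult_vec[OF assms i(1), of x] i yx by simp
    qed
    ultimately show ?R by blast
  next
    assume ?R
    then obtain x v where v: "v \<in> pverts G" "x v \<noteq> 0" and
      x: "\<forall>v \<in> pverts G. (\<Sum>w \<in> {w \<in> pverts G. (v, w) \<in> parcs G}. x w) = k * x v"
      by blast
    define y where "y = vec ?n (\<lambda>j. x (vs ! j))"
    from v(1) assms(2) obtain i where i: "i < ?n" "vs ! i = v"
      by (metis in_set_conv_nth)
    have "y \<noteq> 0\<^sub>v ?n"
    proof
      assume "y = 0\<^sub>v ?n"
      then have "y $ i = 0" using i by simp
      then show False using i v by (simp add: y_def)
    qed
    moreover have "adjacency_matrix vs G *\<^sub>v y = k \<cdot>\<^sub>v y"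
    proof (intro eq_vecI)
      fix l assume "l < dim_vec (k \<cdot>\<^sub>v y)"
      then have l: "l < ?n" by (simp add: y_def)
      then have "vs ! l \<in> pverts G" using assms(2) nth_mem by blast
      then show "(adjacency_matrix vs G *\<^sub>v y) $ l = (k \<cdot>\<^sub>v y) $ l"
        using adjacency_matrix_mult_vec[OF assms l, of x] x l by (simp add: y_def)
    qed (simp add: y_def dim)
    moreover have "y \<in> carrier_vec ?n"
      by (simp add: y_def)
    ultimately show ?L
      unfolding eigenvalue_def eigenvector_def dim by blast
  }
qed

lemma bipartite_turan_complete_bipartite:
  "K\<^bsub>nat \<lceil>real n / 2\<rceil>, nat \<lfloor>real n / 2\<rfloor>\<^esub> (with_proj (bipartite_turan n))"
proof -
  define k where "k = nat \<lceil>real n / 2\<rceil>"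
  have k: "k \<le> n" "nat \<lfloor>real n / 2\<rfloor> = n - k"
    unfolding k_def by linarith+
  show ?thesis
    unfolding complete_bipartite_digraph_pair_def bipartite_turan_def Let_def
      complete_bipartite_on_def k_def[symmetric] k(2)
    by (intro conjI exI[of _ "{0..<k}"] exI[of _ "{k..<n}"]) (auto simp: k_def)
qed

lemma card_triangle:
  assumes "pair_graph G" "T \<in> triangles G"
  shows "T \<subseteq> pverts G" "card T = 3"
proof -
  interpret pair_graph G by fact
  from assms(2) obtain u v w where T: "T = {u, v, w}"
    "(u, v) \<in> parcs G" "(v, w) \<in> parcs G" "(u, w) \<in> parcs G"
    by (auto simp: triangles_def)
  then have "u \<noteq> v" "v \<noteq> w" "u \<noteq> w" by (auto dest: pair_no_loops)
  with T show "T \<subseteq> pverts G" "card T = 3" by (auto dest: in_arcsD1 in_arcsD2)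
qed

end

theory Submission
  imports Defs "HOL-Analysis.Function_Topology" "HOL-Analysis.Convex"
begin

text \<open>
  Suppose that \<open>G\<close> has \<open>m\<close> edges and \<open>t < s n / 2 - 5 s\<^sup>2\<close> triangles. The idea is that \<open>G\<close> is then so
  close to a balanced complete bipartite graph that each of the at least \<open>s\<close> edges that spoil
  bipartiteness lies in almost \<open>n / 2\<close> triangles.

  The spectral hypothesis enters only through the number of edges. The inequality of Bollobas and
  Nikiforov, \<open>3 t \<ge> \<lambda> (\<lambda>\<^sup>2 - m)\<close> (\<open>spectral_radius_triangle_inequality\<close>), together with
  \<open>\<lambda>\<^sup>2 \<ge> (n\<^sup>2 - 1) / 4\<close> yields \<open>m \<ge> n\<^sup>2 / 4 - 3 s\<close>. It is proved by evaluating a trace that is nonnegative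
  because no eigenvalue is below \<open>- \<lambda>\<close>.

  With so many edges and so few triangles, an average edge \<open>u v\<close> has
  \<open>d(u) + d(v) - codeg(u, v)\<close> within less than \<open>1\<close> of \<open>n\<close>. Hence for a positive fraction of the edges
  the neighbourhoods of the two ends cover all vertices, and for one of these edges both
  neighbourhoods span few edges (\<open>spanning_arc_with_sparse_neighbourhoods\<close>). The neighbourhood \<open>A\<close>
  of \<open>u\<close> and its complement \<open>B\<close> form a bipartition with a number \<open>k\<close> of inner edges that is below
  \<open>n / 2 - 4 s - 1 / 4\<close>.

  Picking one end of each inner edge covers all triangles, so \<open>k \<ge> s\<close>. Each inner edge lies in at least
  \<open>min |A| |B| - M\<close> triangles with the third vertex on the other side, where
  \<open>M = |A| |B| - (m - k)\<close> counts the missing crossing pairs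
  (\<open>triangles_from_inner_edges\<close>). So \<open>t \<ge> k (n / 2 - 3 s - k - 1 / 4)\<close>, and by concavity in \<open>k\<close> this is at
  least \<open>s (n / 2 - 4 s - 1 / 4)\<close>, which contradicts the assumption.

  Edges and triangles are counted in ordered form throughout, as \<open>2 m\<close> arcs and at most \<open>6 t\<close> ordered
  triangles.
\<close>

section \<open>Rayleigh quotients of symmetric kernels\<close>

definition bilinear_form :: "'a set \<Rightarrow> ('a \<Rightarrow> 'a \<Rightarrow> real) \<Rightarrow> ('a \<Rightarrow> real) \<Rightarrow> ('a \<Rightarrow> real) \<Rightarrow> real" where
  "bilinear_form V a x y = (\<Sum>u\<in>V. \<Sum>w\<in>V. a u w * x u * y w)"

text \<open>
  The unit sphere on a finite vertex set is compact once functions are forced to vanish off \<open>V\<close>: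
  it is a closed subset of a product of intervals and singletons. This keeps the argument free of
  a fixed dimension.
\<close>
lemma bilinear_form_maximum_attained:
  fixes a :: "'a \<Rightarrow> 'a \<Rightarrow> real"
  assumes "finite V" "V \<noteq> {}"
  obtains x where "(\<Sum>v\<in>V. (x v)\<^sup>2) = 1"
    and "\<And>y. (\<Sum>v\<in>V. (y v)\<^sup>2) = 1 \<Longrightarrow> bilinear_form V a y y \<le> bilinear_form V a x x"
proof -
  define B where "B = (\<Pi>\<^sub>E i\<in>UNIV. if i \<in> V then {-1..1::real} else {0})"
  define S where "S = B \<inter> {x. (\<Sum>v\<in>V. (x v)\<^sup>2) = 1}"
  have "compactin (product_topology (\<lambda>i. euclidean) UNIV) B"
    unfolding B_def compactin_PiE by auto
  then have "compact B"
    by (simp add: euclidean_product_topology)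
  moreover have cont: "continuous_on UNIV (\<lambda>x::'a \<Rightarrow> real. x v)" for v
    by simp
  have "closed {x::'a \<Rightarrow> real. (\<Sum>v\<in>V. (x v)\<^sup>2) = 1}"
    by (intro closed_Collect_eq continuous_intros cont)
  ultimately have "compact S"
    unfolding S_def by (rule compact_Int_closed)
  moreover have extend: "(\<lambda>v. if v \<in> V then y v else 0) \<in> S" if "(\<Sum>v\<in>V. (y v)\<^sup>2) = 1" for y
  proof -
    have "\<bar>y v\<bar> \<le> 1" if "v \<in> V" for v
    proof -
      have "(y v)\<^sup>2 \<le> 1"
        using member_le_sum[of v V "\<lambda>v. (y v)\<^sup>2"] that assms \<open>(\<Sum>v\<in>V. (y v)\<^sup>2) = 1\<close> by auto
      then show ?thesis by (simp add: abs_square_le_1)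
    qed
    moreover have "(\<Sum>v\<in>V. (if v \<in> V then y v else 0)\<^sup>2) = 1"
      using that by simp
    ultimately show ?thesis
      unfolding S_def B_def by (auto simp: abs_le_iff)
  qed
  obtain v0 where "v0 \<in> V" using assms by blast
  then have "(\<Sum>v\<in>V. (if v = v0 then 1 else 0::real)\<^sup>2) = 1"
    using assms by (subst sum.remove[of _ v0]) auto
  then have "(\<lambda>v. if v \<in> V then if v = v0 then 1 else 0 else 0) \<in> S" by (rule extend)
  then have ne: "\<exists>y. y \<in> S" by (rule exI[of "\<lambda>y. y \<in> S"])
  moreover have "continuous_on S (\<lambda>x. bilinear_form V a x x)"
    unfolding bilinear_form_def
    by (intro continuous_intros continuous_on_subset[OF cont]) auto
  ultimately obtain x where x: "x \<in> S"
    "\<And>y. y \<in> S \<Longrightarrow> bilinear_form V a y y \<le> bilinear_form V a x x"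
    using continuous_attains_sup[of S "\<lambda>x. bilinear_form V a x x"] ne by blast
  show ?thesis
  proof
    show "(\<Sum>v\<in>V. (x v)\<^sup>2) = 1" using x(1) by (simp add: S_def)
    fix y :: "'a \<Rightarrow> real" assume "(\<Sum>v\<in>V. (y v)\<^sup>2) = 1"
    from x(2)[OF extend[OF this]]
    show "bilinear_form V a y y \<le> bilinear_form V a x x"
      by (simp add: bilinear_form_def cong: sum.cong)
  qed
qed

text \<open>
  The Rayleigh quotient of a symmetric kernel has a maximizer \<open>x\<close>, and its first variation must vanish
  there: \<open>\<mu> |y|\<^sup>2\<close> minus the form is nonnegative everywhere and zero at \<open>x\<close>, so perturbing \<open>x\<close> by
  \<open>\<epsilon> z\<close> leaves no linear term in \<open>\<epsilon>\<close>. Testing with unit vectors \<open>z\<close> gives the eigenvalue equation.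
\<close>
lemma rayleigh_principle:
  fixes a :: "'a \<Rightarrow> 'a \<Rightarrow> real"
  assumes V: "finite V" "V \<noteq> {}" and sym: "\<And>u v. a u v = a v u"
  obtains x \<mu> where "(\<Sum>v\<in>V. (x v)\<^sup>2) = 1" "\<forall>v\<in>V. (\<Sum>w\<in>V. a v w * x w) = \<mu> * x v"
    and "\<forall>y. bilinear_form V a y y \<le> \<mu> * (\<Sum>v\<in>V. (y v)\<^sup>2)"
proof -
  obtain x where x: "(\<Sum>v\<in>V. (x v)\<^sup>2) = 1"
    and max: "\<And>y. (\<Sum>v\<in>V. (y v)\<^sup>2) = 1 \<Longrightarrow> bilinear_form V a y y \<le> bilinear_form V a x x"
    using bilinear_form_maximum_attained[OF V] by blast
  define \<mu> where "\<mu> = bilinear_form V a x x"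
  have bound: "bilinear_form V a y y \<le> \<mu> * (\<Sum>v\<in>V. (y v)\<^sup>2)" for y
  proof (cases "(\<Sum>v\<in>V. (y v)\<^sup>2) = 0")
    case True
    then have "y v = 0" if "v \<in> V" for v
      using that V by (simp add: sum_nonneg_eq_0_iff)
    then show ?thesis using True by (simp add: bilinear_form_def)
  next
    case False
    define c where "c = sqrt (\<Sum>v\<in>V. (y v)\<^sup>2)"
    have c2: "c\<^sup>2 = (\<Sum>v\<in>V. (y v)\<^sup>2)" by (simp add: c_def sum_nonneg)
    then have "c \<noteq> 0" using False by auto
    have "(\<Sum>v\<in>V. (y v / c)\<^sup>2) = 1"
      using False c2 by (simp add: power_divide sum_divide_distrib[symmetric])
    from max[OF this] have "bilinear_form V a (\<lambda>v. y v / c) (\<lambda>v. y v / c) \<le> \<mu>"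
      by (simp add: \<mu>_def)
    also have "bilinear_form V a (\<lambda>v. y v / c) (\<lambda>v. y v / c) = bilinear_form V a y y / c\<^sup>2"
      by (simp add: bilinear_form_def sum_divide_distrib power2_eq_square)
    finally show ?thesis using \<open>c \<noteq> 0\<close> by (simp add: c2[symmetric] divide_le_eq)
  qed
  have stationary: "bilinear_form V a x z = \<mu> * (\<Sum>v\<in>V. x v * z v)" for z
  proof -
    define b where "b = \<mu> * (\<Sum>v\<in>V. x v * z v) - bilinear_form V a x z"
    define q where "q = \<mu> * (\<Sum>v\<in>V. (z v)\<^sup>2) - bilinear_form V a z z"
    have sym': "bilinear_form V a z x = bilinear_form V a x z"
      unfolding bilinear_form_def by (subst sum.swap) (simp add: sym mult_ac)
    have nonneg: "0 \<le> 2 * \<epsilon> * b + \<epsilon>\<^sup>2 * q" for \<epsilon>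
    proof -
      have "bilinear_form V a (\<lambda>v. x v + \<epsilon> * z v) (\<lambda>v. x v + \<epsilon> * z v)
          = bilinear_form V a x x + \<epsilon> * bilinear_form V a x z + \<epsilon> * bilinear_form V a z x
            + \<epsilon>\<^sup>2 * bilinear_form V a z z"
        by (simp add: bilinear_form_def algebra_simps sum.distrib sum_distrib_left power2_eq_square)
      moreover have "(\<Sum>v\<in>V. (x v + \<epsilon> * z v)\<^sup>2)
          = 1 + 2 * \<epsilon> * (\<Sum>v\<in>V. x v * z v) + \<epsilon>\<^sup>2 * (\<Sum>v\<in>V. (z v)\<^sup>2)"
        unfolding x[symmetric]
        by (simp add: power2_eq_square algebra_simps sum.distrib sum_distrib_left)
      ultimately show ?thesis
        using bound[of "\<lambda>v. x v + \<epsilon> * z v"] sym'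
        by (simp add: \<mu>_def[symmetric] b_def q_def algebra_simps)
    qed
    have "q \<ge> 0" using bound[of z] by (simp add: q_def)
    have "b = 0"
    proof (rule ccontr)
      assume "b \<noteq> 0"
      \<comment> \<open>The choice \<open>\<epsilon> = - b / (q + 1)\<close> is small enough for the linear term to beat the quadratic one.\<close>
      define r where "r = q + 1"
      have r: "r > 0" "q = r - 1" using \<open>q \<ge> 0\<close> by (simp_all add: r_def)
      have "0 \<le> 2 * (- b / r) * b + (- b / r)\<^sup>2 * q" by (rule nonneg)
      also have "\<dots> = - (b\<^sup>2 * (r + 1)) / r\<^sup>2"
        using r(1) unfolding r(2) by (simp add: field_simps power2_eq_square)
      also have "\<dots> < 0"
        using \<open>b \<noteq> 0\<close> r(1) by (intro divide_neg_pos) auto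
      finally show False by simp
    qed
    then show ?thesis by (simp add: b_def)
  qed
  show ?thesis
  proof
    show "(\<Sum>v\<in>V. (x v)\<^sup>2) = 1" by (rule x)
    show "\<forall>v\<in>V. (\<Sum>w\<in>V. a v w * x w) = \<mu> * x v"
    proof
      fix v assume that: "v \<in> V"
      let ?z = "\<lambda>w. if w = v then 1 else 0 :: real"
      have "bilinear_form V a x ?z = (\<Sum>u\<in>V. a u v * x u)"
        using V that by (simp add: bilinear_form_def if_distrib[of "\<lambda>t. _ * t"] cong: if_cong)
      moreover have "(\<Sum>w\<in>V. x w * ?z w) = x v"
        using V that by (simp add: if_distrib[of "\<lambda>t. _ * t"] cong: if_cong)
      ultimately show "(\<Sum>w\<in>V. a v w * x w) = \<mu> * x v"
        using stationary[of ?z] by (simp add: sym[of v])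
    qed
    show "\<forall>y. bilinear_form V a y y \<le> \<mu> * (\<Sum>v\<in>V. (y v)\<^sup>2)" using bound by simp
  qed
qed

text \<open>
  Passing from \<open>y\<close> to its absolute value only increases the form of a nonnegative kernel, so no
  eigenvalue lies below \<open>- \<mu>\<close>. In other words, \<open>a + \<mu> I\<close> is positive semidefinite.
\<close>
lemma nonneg_form_lower_bound:
  assumes nonneg: "\<And>u v. a u v \<ge> 0"
    and bound: "\<And>y. bilinear_form V a y y \<le> \<mu> * (\<Sum>v\<in>V. (y v)\<^sup>2)"
  shows "- \<mu> * (\<Sum>v\<in>V. (y v)\<^sup>2) \<le> bilinear_form V a y y"
proof -
  have "- bilinear_form V a y y \<le> bilinear_form V a (\<lambda>v. \<bar>y v\<bar>) (\<lambda>v. \<bar>y v\<bar>)"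
    unfolding bilinear_form_def sum_negf[symmetric]
  proof (intro sum_mono)
    fix u w
    have "- (y u * y w) \<le> \<bar>y u\<bar> * \<bar>y w\<bar>" by (metis abs_ge_minus_self abs_mult)
    from mult_left_mono[OF this nonneg[of u w]]
    show "- (a u w * y u * y w) \<le> a u w * \<bar>y u\<bar> * \<bar>y w\<bar>" by (simp add: mult.assoc)
  qed
  also have "\<dots> \<le> \<mu> * (\<Sum>v\<in>V. (y v)\<^sup>2)" using bound[of "\<lambda>v. \<bar>y v\<bar>"] by simp
  finally show ?thesis by simp
qed

text \<open>
  This is \<open>tr (b (a + \<mu> I) b) \<ge> 0\<close> for the deflated kernel \<open>b = a - \<mu> x x\<^sup>T\<close>: the trace is a sum over the
  columns of \<open>b\<close> of values of the positive semidefinite form of \<open>a + \<mu> I\<close>. As \<open>x\<close> is a unit eigenvector,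
  \<open>tr (b a b) = tr a\<^sup>3 - \<mu>\<^sup>3\<close> and \<open>tr b\<^sup>2 = tr a\<^sup>2 - \<mu>\<^sup>2\<close>. In terms of eigenvalues this says that the
  cubes of the eigenvalues other than \<open>\<mu>\<close> sum to at least \<open>- \<mu>\<close> times the sum of their squares, but
  no diagonalization is needed.
\<close>
lemma trace_inequality:
  fixes a :: "'a \<Rightarrow> 'a \<Rightarrow> real"
  assumes sym: "\<And>u v. a u v = a v u" and nonneg: "\<And>u v. a u v \<ge> 0"
    and unit: "(\<Sum>v\<in>V. (x v)\<^sup>2) = 1"
    and eigen: "\<forall>v\<in>V. (\<Sum>w\<in>V. a v w * x w) = \<mu> * x v"
    and bound: "\<forall>y. bilinear_form V a y y \<le> \<mu> * (\<Sum>v\<in>V. (y v)\<^sup>2)"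
  shows "2 * \<mu> ^ 3 \<le> (\<Sum>i\<in>V. \<Sum>u\<in>V. \<Sum>w\<in>V. a u w * a u i * a w i)
                      + \<mu> * (\<Sum>i\<in>V. \<Sum>u\<in>V. (a u i)\<^sup>2)"
proof -
  define b where "b i u = a u i - \<mu> * x u * x i" for i u
  have form_x: "bilinear_form V a x x = \<mu>"
  proof -
    have "bilinear_form V a x x = (\<Sum>u\<in>V. x u * (\<Sum>w\<in>V. a u w * x w))"
      by (simp add: bilinear_form_def sum_distrib_left mult_ac)
    also have "\<dots> = (\<Sum>u\<in>V. \<mu> * (x u)\<^sup>2)"
      by (intro sum.cong) (simp_all add: eigen power2_eq_square)
    finally show ?thesis by (simp add: sum_distrib_left[symmetric] unit)
  qed
  have column: "bilinear_form V a (b i) (b i)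
      = (\<Sum>u\<in>V. \<Sum>w\<in>V. a u w * a u i * a w i) - 2 * \<mu>\<^sup>2 * x i * (\<Sum>u\<in>V. a i u * x u) + \<mu> ^ 3 * (x i)\<^sup>2" for i
  proof -
    have l: "(\<Sum>u\<in>V. \<Sum>w\<in>V. a u w * a u i * x w) = \<mu> * (\<Sum>u\<in>V. a i u * x u)"
    proof -
      have "(\<Sum>u\<in>V. \<Sum>w\<in>V. a u w * a u i * x w) = (\<Sum>u\<in>V. a u i * (\<Sum>w\<in>V. a u w * x w))"
        by (simp add: sum_distrib_left mult_ac)
      also have "\<dots> = (\<Sum>u\<in>V. \<mu> * (a i u * x u))"
        by (intro sum.cong) (simp_all add: eigen sym[of i])
      finally show ?thesis by (simp add: sum_distrib_left)
    qed
    have r: "(\<Sum>u\<in>V. \<Sum>w\<in>V. a u w * x u * a w i) = \<mu> * (\<Sum>u\<in>V. a i u * x u)"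
      unfolding l[symmetric] by (subst sum.swap) (simp add: sym mult_ac)
    have "bilinear_form V a (b i) (b i)
        = (\<Sum>u\<in>V. \<Sum>w\<in>V. a u w * a u i * a w i)
          - \<mu> * x i * (\<Sum>u\<in>V. \<Sum>w\<in>V. a u w * a u i * x w)
          - \<mu> * x i * (\<Sum>u\<in>V. \<Sum>w\<in>V. a u w * x u * a w i)
          + \<mu>\<^sup>2 * (x i)\<^sup>2 * bilinear_form V a x x"
      by (simp add: bilinear_form_def b_def algebra_simps sum.distrib sum_subtractf sum_distrib_left
          power2_eq_square)
    then show ?thesis
      unfolding l r form_x by (simp add: algebra_simps power2_eq_square power3_eq_cube)
  qed
  have norm: "(\<Sum>u\<in>V. (b i u)\<^sup>2)
      = (\<Sum>u\<in>V. (a u i)\<^sup>2) - 2 * \<mu> * x i * (\<Sum>u\<in>V. a i u * x u) + \<mu>\<^sup>2 * (x i)\<^sup>2" for i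
  proof -
    have "(\<Sum>u\<in>V. (b i u)\<^sup>2) = (\<Sum>u\<in>V. (a u i)\<^sup>2) - 2 * \<mu> * x i * (\<Sum>u\<in>V. a u i * x u)
        + \<mu>\<^sup>2 * (x i)\<^sup>2 * (\<Sum>u\<in>V. (x u)\<^sup>2)"
      by (simp add: b_def algebra_simps sum.distrib sum_subtractf sum_distrib_left power2_eq_square)
    then show ?thesis by (simp add: unit sym[of i])
  qed
  have "0 \<le> (\<Sum>i\<in>V. bilinear_form V a (b i) (b i) + \<mu> * (\<Sum>u\<in>V. (b i u)\<^sup>2))"
    using nonneg_form_lower_bound[of a V \<mu> "b i" for i, OF nonneg bound[rule_format]]
    by (intro sum_nonneg) (smt (verit) mult_minus_left)
  also have "\<dots> = (\<Sum>i\<in>V. ((\<Sum>u\<in>V. \<Sum>w\<in>V. a u w * a u i * a w i) + \<mu> * (\<Sum>u\<in>V. (a u i)\<^sup>2))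
                    - 2 * \<mu> ^ 3 * (x i)\<^sup>2)"
  proof (intro sum.cong refl)
    fix i assume "i \<in> V"
    from eigen[rule_format, OF this]
    show "bilinear_form V a (b i) (b i) + \<mu> * (\<Sum>u\<in>V. (b i u)\<^sup>2)
        = (\<Sum>u\<in>V. \<Sum>w\<in>V. a u w * a u i * a w i) + \<mu> * (\<Sum>u\<in>V. (a u i)\<^sup>2) - 2 * \<mu> ^ 3 * (x i)\<^sup>2"
      by (simp only: column norm) (simp add: algebra_simps power2_eq_square power3_eq_cube)
  qed
  also have "\<dots> = (\<Sum>i\<in>V. \<Sum>u\<in>V. \<Sum>w\<in>V. a u w * a u i * a w i)
                  + \<mu> * (\<Sum>i\<in>V. \<Sum>u\<in>V. (a u i)\<^sup>2) - 2 * \<mu> ^ 3"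
    by (simp add: sum.distrib sum_subtractf sum_distrib_left[symmetric] unit)
  finally show ?thesis by simp
qed

section \<open>The spectral radius and the number of triangles\<close>

lemma eigenvalue_le_graph_spectral_radius:
  assumes fin: "finite (pverts G)" and "v \<in> pverts G" "x v \<noteq> 0"
    and "\<And>v. v \<in> pverts G \<Longrightarrow> (\<Sum>w \<in> {w \<in> pverts G. (v, w) \<in> parcs G}. x w) = k * x v"
  shows "k \<le> graph_spectral_radius G"
proof -
  have "k \<in> spectrum (adjacency_matrix (vertex_enum G) G)"
    unfolding spectrum_def mem_Collect_eq eigenvalue_adjacency_matrix_iff[OF vertex_enum[OF fin]]
    using assms(2-4) by blast
  moreover have "finite (spectrum (adjacency_matrix (vertex_enum G) G))"
    by (rule card_finite_spectrum(1)[of _ "length (vertex_enum G)"]) (simp add: adjacency_matrix_def)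
  ultimately show ?thesis
    unfolding graph_spectral_radius_def by (rule Max_ge[rotated])
qed

lemma graph_spectral_radius_is_eigenvalue:
  assumes fin: "finite (pverts G)" and ex: "\<exists>k. eigenvalue (adjacency_matrix (vertex_enum G) G) k"
  obtains x v where "v \<in> pverts G" "x v \<noteq> 0"
    and "\<forall>v\<in>pverts G. (\<Sum>w \<in> {w \<in> pverts G. (v, w) \<in> parcs G}. x w)
           = graph_spectral_radius G * x v"
proof -
  let ?S = "spectrum (adjacency_matrix (vertex_enum G) G)"
  have "finite ?S"
    by (rule card_finite_spectrum(1)[of _ "length (vertex_enum G)"]) (simp add: adjacency_matrix_def)
  moreover have "?S \<noteq> {}" using ex by (auto simp: spectrum_def)
  ultimately have "graph_spectral_radius G \<in> ?S"
    unfolding graph_spectral_radius_def by (rule Max_in)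
  then show ?thesis
    unfolding spectrum_def mem_Collect_eq eigenvalue_adjacency_matrix_iff[OF vertex_enum[OF fin]]
    using that by blast
qed

definition ordered_triangles :: "'a pair_pre_digraph \<Rightarrow> ('a \<times> 'a \<times> 'a) set" where
  "ordered_triangles G =
     {(u, v, w). (u, v) \<in> parcs G \<and> (v, w) \<in> parcs G \<and> (u, w) \<in> parcs G}"

definition nbrs :: "'a pair_pre_digraph \<Rightarrow> 'a \<Rightarrow> 'a set" where
  "nbrs G v = {w. (v, w) \<in> parcs G}"

context pair_graph
begin

lemma parcs_subset: "parcs G \<subseteq> pverts G \<times> pverts G"
  using in_arcsD1 in_arcsD2 by auto

lemma parcs_commute: "(u, v) \<in> parcs G \<longleftrightarrow> (v, u) \<in> parcs G"
  using arcs_symmetric by blast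

lemma parcs_irrefl: "(v, v) \<notin> parcs G"
  using pair_no_loops[of "(v, v)"] by auto

lemma finite_parcs: "finite (parcs G)"
  using finite_subset[OF parcs_subset] pair_finite_verts by blast

lemma nbrs_subset: "nbrs G v \<subseteq> pverts G"
  using parcs_subset by (auto simp: nbrs_def)

lemma finite_nbrs: "finite (nbrs G v)"
  using finite_subset[OF nbrs_subset] pair_finite_verts by blast

lemma parcs_Sigma: "parcs G = Sigma (pverts G) (nbrs G)"
  using parcs_subset by (auto simp: nbrs_def)

text \<open>
  The maximum of the Rayleigh quotient is an eigenvalue, and it bounds every eigenvalue because it
  bounds the form at the eigenvectors. Hence it is the largest one, which carries the variational
  information over to \<^const>\<open>graph_spectral_radius\<close>.
\<close>
lemma graph_spectral_radius_rayleigh: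
  assumes "pverts G \<noteq> {}"
  defines "a \<equiv> \<lambda>u v. of_bool ((u, v) \<in> parcs G) :: real"
  obtains x where "(\<Sum>v\<in>pverts G. (x v)\<^sup>2) = 1"
    and "\<forall>v\<in>pverts G. (\<Sum>w\<in>pverts G. a v w * x w) = graph_spectral_radius G * x v"
    and "\<forall>y. bilinear_form (pverts G) a y y \<le> graph_spectral_radius G * (\<Sum>v\<in>pverts G. (y v)\<^sup>2)"
proof -
  let ?V = "pverts G"
  have sym: "a u v = a v u" for u v
    using parcs_commute[of u v] by (simp add: a_def)
  have nbr_sum: "(\<Sum>w\<in>{w \<in> ?V. (v, w) \<in> parcs G}. x w) = (\<Sum>w\<in>?V. a v w * x w)"
    for v and x :: "'a \<Rightarrow> real"
    unfolding sum.inter_filter[OF pair_finite_verts] by (intro sum.cong) (auto simp: a_def)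
  obtain x \<mu> where x: "(\<Sum>v\<in>?V. (x v)\<^sup>2) = 1"
    and eig: "\<forall>v\<in>?V. (\<Sum>w\<in>?V. a v w * x w) = \<mu> * x v"
    and bound: "\<forall>y. bilinear_form ?V a y y \<le> \<mu> * (\<Sum>v\<in>?V. (y v)\<^sup>2)"
    by (rule rayleigh_principle[OF pair_finite_verts assms(1), of a, OF sym])
  have "\<exists>v\<in>?V. x v \<noteq> 0"
  proof (rule ccontr)
    assume "\<not> ?thesis"
    then have "(\<Sum>v\<in>?V. (x v)\<^sup>2) = 0" by simp
    then show False using x by simp
  qed
  then obtain v where v: "v \<in> ?V" "x v \<noteq> 0" by blast
  have le: "\<mu> \<le> graph_spectral_radius G"
    by (rule eigenvalue_le_graph_spectral_radius[of G v x, OF pair_finite_verts v]) (simp add: nbr_sum eig)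
  have "eigenvalue (adjacency_matrix (vertex_enum G) G) \<mu>"
    unfolding eigenvalue_adjacency_matrix_iff[OF vertex_enum[OF pair_finite_verts]] nbr_sum
    using v eig by (intro exI[of _ x]) blast
  then have ex: "\<exists>k. eigenvalue (adjacency_matrix (vertex_enum G) G) k" by blast
  obtain z w where w: "w \<in> ?V" "z w \<noteq> 0"
    and z: "\<forall>v\<in>?V. (\<Sum>w\<in>?V. a v w * z w) = graph_spectral_radius G * z v"
    by (rule graph_spectral_radius_is_eigenvalue[OF pair_finite_verts ex, unfolded nbr_sum])
  have "bilinear_form ?V a z z = (\<Sum>u\<in>?V. z u * (\<Sum>w\<in>?V. a u w * z w))"
    by (simp add: bilinear_form_def sum_distrib_left mult_ac)
  also have "\<dots> = (\<Sum>u\<in>?V. graph_spectral_radius G * (z u)\<^sup>2)"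
    by (intro sum.cong) (simp_all add: z power2_eq_square)
  finally have "graph_spectral_radius G * (\<Sum>u\<in>?V. (z u)\<^sup>2) \<le> \<mu> * (\<Sum>u\<in>?V. (z u)\<^sup>2)"
    using bound[rule_format, of z] by (simp add: sum_distrib_left)
  moreover have "(\<Sum>u\<in>?V. (z u)\<^sup>2) > 0"
    using w by (intro sum_pos2[of _ w]) auto
  ultimately have "\<mu> = graph_spectral_radius G" using le by simp
  with that[of x] x eig bound show ?thesis by simp
qed

text \<open>
  The inequality of Bollobas and Nikiforov, \<open>t \<ge> \<lambda> (\<lambda>\<^sup>2 - m) / 3\<close>: the trace inequality for the
  adjacency kernel, where \<open>tr a\<^sup>3\<close> counts the \<open>6 t\<close> ordered triangles and \<open>tr a\<^sup>2\<close> the \<open>2 m\<close> arcs.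
\<close>
lemma spectral_radius_triangle_inequality:
  assumes "pverts G \<noteq> {}"
  shows "2 * graph_spectral_radius G ^ 3
       \<le> real (card (ordered_triangles G)) + graph_spectral_radius G * real (card (parcs G))"
proof -
  let ?V = "pverts G"
  define a where "a u v = (of_bool ((u, v) \<in> parcs G) :: real)" for u v
  obtain x where x: "(\<Sum>v\<in>?V. (x v)\<^sup>2) = 1"
    "\<forall>v\<in>?V. (\<Sum>w\<in>?V. a v w * x w) = graph_spectral_radius G * x v"
    "\<forall>y. bilinear_form ?V a y y \<le> graph_spectral_radius G * (\<Sum>v\<in>?V. (y v)\<^sup>2)"
    by (rule graph_spectral_radius_rayleigh[OF assms, folded a_def])
  have sym: "a u v = a v u" for u v
    using parcs_commute[of u v] by (simp add: a_def)
  have "(\<Sum>i\<in>?V. \<Sum>u\<in>?V. (a u i)\<^sup>2) = (\<Sum>(i, u)\<in>?V \<times> ?V. of_bool ((i, u) \<in> parcs G))"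
    unfolding sum.cartesian_product
  proof (intro sum.cong refl, clarify)
    fix i u
    show "(a u i)\<^sup>2 = of_bool ((i, u) \<in> parcs G)"
      using parcs_commute[of u i] by (simp add: a_def)
  qed
  also have "\<dots> = real (card (parcs G))"
  proof -
    have "?V \<times> ?V \<inter> parcs G = parcs G" using parcs_subset by blast
    then show ?thesis using pair_finite_verts by (simp add: case_prod_unfold)
  qed
  finally have edges: "(\<Sum>i\<in>?V. \<Sum>u\<in>?V. (a u i)\<^sup>2) = real (card (parcs G))" .
  have "(\<Sum>i\<in>?V. \<Sum>u\<in>?V. \<Sum>w\<in>?V. a u w * a u i * a w i)
      = (\<Sum>t\<in>?V \<times> ?V \<times> ?V. of_bool (t \<in> ordered_triangles G))"
    unfolding sum.cartesian_product
  proof (intro sum.cong refl, clarify)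
    fix i u w
    show "a u w * a u i * a w i = of_bool ((i, u, w) \<in> ordered_triangles G)"
      using parcs_commute[of u i] parcs_commute[of w i] by (simp add: a_def ordered_triangles_def)
  qed
  also have "\<dots> = real (card (ordered_triangles G))"
  proof -
    have "?V \<times> ?V \<times> ?V \<inter> ordered_triangles G = ordered_triangles G"
      using parcs_subset by (auto simp: ordered_triangles_def)
    then show ?thesis using pair_finite_verts by simp
  qed
  finally have triples: "(\<Sum>i\<in>?V. \<Sum>u\<in>?V. \<Sum>w\<in>?V. a u w * a u i * a w i)
      = real (card (ordered_triangles G))" .
  have "0 \<le> a u v" for u v by (simp add: a_def)
  from trace_inequality[of a, OF sym this x] show ?thesis by (simp only: edges triples)
qed

lemma finite_triangles: "finite (triangles G)"
  using card_triangle(1)[OF pair_graph] pair_finite_verts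
  by (intro finite_subset[of "triangles G" "Pow (pverts G)"]) auto

lemma card_ordered_triangles_le: "card (ordered_triangles G) \<le> 6 * card (triangles G)"
proof -
  define orders where "orders T = {(u, v, w). {u, v, w} = T}" for T :: "'a set"
  have orders: "finite (orders T \<inter> ordered_triangles G) \<and> card (orders T \<inter> ordered_triangles G) \<le> 6"
    if T_tri: "T \<in> triangles G" for T
  proof -
    obtain a b c where T: "T = {a, b, c}" "a \<noteq> b" "b \<noteq> c" "a \<noteq> c"
      using card_triangle(2)[OF pair_graph T_tri] by (auto simp: card_3_iff)
    have sub: "orders T \<inter> ordered_triangles G \<subseteq>
        set [(a,b,c), (a,c,b), (b,a,c), (b,c,a), (c,a,b), (c,b,a)]"
    proof
      fix t assume t: "t \<in> orders T \<inter> ordered_triangles G"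
      obtain u v w where uvw: "t = (u, v, w)" by (cases t)
      have "{u, v, w} = {a, b, c}" and distinct: "u \<noteq> v" "v \<noteq> w" "u \<noteq> w"
        using t T(1) by (auto simp: uvw orders_def ordered_triangles_def parcs_irrefl)
      then have "u \<in> {a, b, c}" "v \<in> {a, b, c}" "w \<in> {a, b, c}" by blast+
      with distinct show "t \<in> set [(a,b,c), (a,c,b), (b,a,c), (b,c,a), (c,a,b), (c,b,a)]"
        unfolding uvw by auto
    qed
    show ?thesis
      using finite_subset[OF sub finite_set] order_trans[OF card_mono[OF finite_set sub] card_length] by simp
  qed
  have "ordered_triangles G = (\<Union>T\<in>triangles G. orders T \<inter> ordered_triangles G)"
  proof (intro equalityI subsetI)
    fix t assume t: "t \<in> ordered_triangles G"
    obtain u v w where uvw: "t = (u, v, w)" by (cases t)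
    have "{u, v, w} \<in> triangles G"
      using t unfolding uvw ordered_triangles_def triangles_def by blast
    moreover have "t \<in> orders {u, v, w}" by (simp add: uvw orders_def)
    ultimately show "t \<in> (\<Union>T\<in>triangles G. orders T \<inter> ordered_triangles G)" using t by blast
  qed blast
  then have "card (ordered_triangles G) \<le> (\<Sum>T\<in>triangles G. card (orders T \<inter> ordered_triangles G))"
    using card_UN_le[OF finite_triangles] by metis
  also have "\<dots> \<le> (\<Sum>T\<in>triangles G. 6)"
    using orders by (intro sum_mono) blast
  finally show ?thesis by simp
qed

end

text \<open>
  For parts of sizes \<open>k\<close> and \<open>n - k\<close>, weighting each vertex by the square root of the size of the
  opposite part gives an eigenvector with eigenvalue \<open>sqrt (k (n - k))\<close>. A lower bound on the
  spectral radius is all that the comparison with \<open>G\<close> requires.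
\<close>
lemma bipartite_turan_spectral_radius:
  assumes "n \<ge> 2"
  shows "sqrt (real (n\<^sup>2 - 1) / 4) \<le> graph_spectral_radius (bipartite_turan n)"
proof -
  define k where "k = nat \<lceil>real n / 2\<rceil>"
  have k: "2 * k = n \<or> 2 * k = n + 1" "k \<le> n"
    unfolding k_def by linarith+
  have k0: "k > 0" using k assms by auto
  have G: "pverts (bipartite_turan n) = {0..<n}"
    "parcs (bipartite_turan n) = {0..<k} \<times> {k..<n} \<union> {k..<n} \<times> {0..<k}"
    using k(2) by (auto simp: bipartite_turan_def complete_bipartite_on_def Let_def k_def[symmetric])
  define x where "x v = (if v < k then sqrt (real (n - k)) else sqrt (real k))" for v
  have "sqrt (real (n - k)) * sqrt (real k) \<le> graph_spectral_radius (bipartite_turan n)"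
  proof (rule eigenvalue_le_graph_spectral_radius)
    show "finite (pverts (bipartite_turan n))" by (simp add: G)
    show "n - 1 \<in> pverts (bipartite_turan n)" using assms by (simp add: G)
    show "x (n - 1) \<noteq> 0" using k assms by (auto simp: x_def)
    fix v assume v: "v \<in> pverts (bipartite_turan n)"
    show "(\<Sum>w\<in>{w \<in> pverts (bipartite_turan n). (v, w) \<in> parcs (bipartite_turan n)}. x w)
        = sqrt (real (n - k)) * sqrt (real k) * x v"
    proof (cases "v < k")
      case True
      have "{w \<in> pverts (bipartite_turan n). (v, w) \<in> parcs (bipartite_turan n)} = {k..<n}"
        using True by (auto simp: G)
      then show ?thesis using True by (simp add: x_def)
    next
      case False
      have "{w \<in> pverts (bipartite_turan n). (v, w) \<in> parcs (bipartite_turan n)} = {0..<k}"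
        using False v k(2) by (auto simp: G)
      then show ?thesis using False by (simp add: x_def)
    qed
  qed
  moreover have "real (n\<^sup>2 - 1) / 4 \<le> real (n - k) * real k"
  proof -
    have "n\<^sup>2 - 1 \<le> 4 * ((n - k) * k)"
      using k(1)
    proof
      assume "2 * k = n"
      then have "n = k + k" by simp
      then show ?thesis by (simp add: power2_eq_square algebra_simps)
    next
      assume "2 * k = n + 1"
      define j where "j = k - 1"
      have "k = Suc j" "n = j + j + 1" using k0 \<open>2 * k = n + 1\<close> unfolding j_def by linarith+
      then show ?thesis by (simp add: power2_eq_square algebra_simps)
    qed
    then have "real (n\<^sup>2 - 1) \<le> real (4 * ((n - k) * k))" by (rule of_nat_mono)
    then show ?thesis by simp
  qed
  then have "sqrt (real (n\<^sup>2 - 1) / 4) \<le> sqrt (real (n - k)) * sqrt (real k)"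
    unfolding real_sqrt_mult[symmetric] by (rule real_sqrt_le_mono)
  ultimately show ?thesis by linarith
qed

section \<open>An arc whose ends dominate the graph\<close>

context pair_graph
begin
lemma sum_parcs_fst: "(\<Sum>(u, v)\<in>parcs G. f u) = (\<Sum>u\<in>pverts G. real (card (nbrs G u)) * f u)"
proof -
  have "(\<Sum>u\<in>pverts G. \<Sum>v\<in>nbrs G u. f u) = (\<Sum>(u, v)\<in>Sigma (pverts G) (nbrs G). f u)"
    using pair_finite_verts finite_nbrs by (intro sum.Sigma) auto
  then show ?thesis by (simp add: parcs_Sigma)
qed

lemma sum_parcs_swap: "(\<Sum>(u, v)\<in>parcs G. f v) = (\<Sum>(u, v)\<in>parcs G. f u)"
  using arcs_symmetric
  by (intro sum.reindex_bij_witness[of _ "\<lambda>(u, v). (v, u)" "\<lambda>(u, v). (v, u)"]) auto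

lemma card_parcs_eq_sum_degrees: "real (card (parcs G)) = (\<Sum>u\<in>pverts G. real (card (nbrs G u)))"
  using sum_parcs_fst[of "\<lambda>_. 1"] by simp

lemma card_parcs_squared_le:
  "(real (card (parcs G)))\<^sup>2 \<le> real (card (pverts G)) * (\<Sum>u\<in>pverts G. (real (card (nbrs G u)))\<^sup>2)"
  using sum_squared_le_sum_of_squares[of "\<lambda>u. real (card (nbrs G u))" "pverts G"]
  by (simp add: card_parcs_eq_sum_degrees mult.commute)

definition arcs_within :: "'a set \<Rightarrow> ('a \<times> 'a) set" where
  "arcs_within A = {(x, y) \<in> parcs G. x \<in> A \<and> y \<in> A}"

lemma finite_arcs_within: "finite (arcs_within A)"
  using finite_parcs by (rule finite_subset[rotated]) (auto simp: arcs_within_def)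

text \<open>The arcs inside the neighbourhood of \<open>u\<close> are the ordered triangles starting at \<open>u\<close>.\<close>
lemma sum_arcs_within_nbrs:
  "(\<Sum>u\<in>pverts G. card (arcs_within (nbrs G u))) = card (ordered_triangles G)"
proof -
  have "ordered_triangles G = Sigma (pverts G) (\<lambda>u. arcs_within (nbrs G u))"
    using parcs_subset by (auto simp: ordered_triangles_def arcs_within_def nbrs_def)
  then show ?thesis
    using pair_finite_verts finite_arcs_within by simp
qed

lemma sum_codegrees:
  "(\<Sum>(u, v)\<in>parcs G. card (nbrs G u \<inter> nbrs G v)) = card (ordered_triangles G)"
proof -
  have "ordered_triangles G = (\<lambda>((u, v), w). (u, v, w)) ` Sigma (parcs G) (\<lambda>(u, v). nbrs G u \<inter> nbrs G v)"
    by (force simp: ordered_triangles_def nbrs_def image_iff)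
  moreover have "inj_on (\<lambda>((u, v), w). (u, v, w)) (Sigma (parcs G) (\<lambda>(u, v). nbrs G u \<inter> nbrs G v))"
    by (auto simp: inj_on_def)
  ultimately have "card (ordered_triangles G) = card (Sigma (parcs G) (\<lambda>(u, v). nbrs G u \<inter> nbrs G v))"
    by (simp add: card_image)
  also have "\<dots> = (\<Sum>p\<in>parcs G. card (case p of (u, v) \<Rightarrow> nbrs G u \<inter> nbrs G v))"
    using finite_parcs finite_nbrs by (intro card_SigmaI) auto
  finally show ?thesis by (simp add: case_prod_unfold)
qed

definition missed :: "'a \<times> 'a \<Rightarrow> 'a set" where
  "missed = (\<lambda>(u, v). pverts G - (nbrs G u \<union> nbrs G v))"

text \<open>
  Inclusion and exclusion at each arc. The degrees of the two ends sum up to twice the sum of squared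
  degrees, and the codegrees to the number of ordered triangles.
\<close>
lemma sum_missed:
  "(\<Sum>p\<in>parcs G. real (card (missed p)))
     = real (card (pverts G)) * real (card (parcs G))
       - 2 * (\<Sum>u\<in>pverts G. (real (card (nbrs G u)))\<^sup>2) + real (card (ordered_triangles G))"
proof -
  have one: "real (card (missed (u, v))) = real (card (pverts G)) - real (card (nbrs G u))
      - real (card (nbrs G v)) + real (card (nbrs G u \<inter> nbrs G v))" for u v
  proof -
    have "card (nbrs G u \<union> nbrs G v) \<le> card (pverts G)"
      using nbrs_subset pair_finite_verts by (intro card_mono) auto
    moreover have "card (missed (u, v)) = card (pverts G) - card (nbrs G u \<union> nbrs G v)"
      unfolding missed_def using nbrs_subset finite_nbrs by (simp add: card_Diff_subset)
    ultimately show ?thesis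
      using card_Un_Int[OF finite_nbrs finite_nbrs, of u v] by linarith
  qed
  have "(\<Sum>p\<in>parcs G. real (card (missed p)))
      = (\<Sum>(u, v)\<in>parcs G. real (card (pverts G)) - real (card (nbrs G u))
          - real (card (nbrs G v)) + real (card (nbrs G u \<inter> nbrs G v)))"
    by (intro sum.cong) (auto simp: one)
  also have "\<dots> = (\<Sum>(u, v)\<in>parcs G. real (card (pverts G)))
      - (\<Sum>(u, v)\<in>parcs G. real (card (nbrs G u))) - (\<Sum>(u, v)\<in>parcs G. real (card (nbrs G v)))
      + (\<Sum>(u, v)\<in>parcs G. real (card (nbrs G u \<inter> nbrs G v)))"
    by (simp add: case_prod_unfold sum.distrib sum_subtractf)
  also have "(\<Sum>(u, v)\<in>parcs G. real (card (nbrs G v))) = (\<Sum>u\<in>pverts G. (real (card (nbrs G u)))\<^sup>2)"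
    unfolding sum_parcs_swap[of "\<lambda>v. real (card (nbrs G v))"] sum_parcs_fst
    by (simp add: power2_eq_square)
  also have "(\<Sum>(u, v)\<in>parcs G. real (card (nbrs G u))) = (\<Sum>u\<in>pverts G. (real (card (nbrs G u)))\<^sup>2)"
    unfolding sum_parcs_fst by (simp add: power2_eq_square)
  also have "(\<Sum>(u, v)\<in>parcs G. real (card (nbrs G u \<inter> nbrs G v))) = real (card (ordered_triangles G))"
    unfolding sum_codegrees[symmetric] by (simp add: case_prod_unfold)
  finally show ?thesis by (simp add: case_prod_unfold)
qed

lemma sum_arcs_within_endpoints_le:
  "(\<Sum>(u, v)\<in>parcs G. real (card (arcs_within (nbrs G u)) + card (arcs_within (nbrs G v))))
     \<le> 2 * real (card (pverts G)) * real (card (ordered_triangles G))"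
proof -
  let ?T = "\<lambda>u. real (card (arcs_within (nbrs G u)))"
  have "(\<Sum>(u, v)\<in>parcs G. ?T u) = (\<Sum>u\<in>pverts G. real (card (nbrs G u)) * ?T u)"
    by (rule sum_parcs_fst)
  also have "\<dots> \<le> (\<Sum>u\<in>pverts G. real (card (pverts G)) * ?T u)"
    by (intro sum_mono mult_right_mono) (auto intro: card_mono[OF pair_finite_verts nbrs_subset])
  also have "\<dots> = real (card (pverts G)) * real (card (ordered_triangles G))"
    by (simp add: sum_distrib_left[symmetric] sum_arcs_within_nbrs[symmetric])
  finally have half: "(\<Sum>(u, v)\<in>parcs G. ?T u) \<le> real (card (pverts G)) * real (card (ordered_triangles G))" .
  have "(\<Sum>(u, v)\<in>parcs G. real (card (arcs_within (nbrs G u)) + card (arcs_within (nbrs G v))))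
      = (\<Sum>(u, v)\<in>parcs G. ?T u) + (\<Sum>(u, v)\<in>parcs G. ?T v)"
    by (simp add: case_prod_unfold sum.distrib)
  then show ?thesis
    using half by (simp add: sum_parcs_swap[of ?T])
qed

text \<open>
  A double average over arcs. By Cauchy-Schwarz on the degrees, the arcs miss few vertices in total;
  an arc that misses any vertex contributes at least one, so at least \<open>e - (n e - 2 e\<^sup>2 / n + t)\<close> arcs
  miss none. If the neighbourhoods of the ends of each of these arcs contained \<open>L\<close> or more arcs, then
  the total over all arcs would exceed its bound \<open>2 n t\<close>.

  Such an arc yields a nearly bipartite splitting: the neighbourhood of \<open>u\<close> and its complement,
  which lies in the neighbourhood of \<open>v\<close>, both span few edges.
\<close>
lemma spanning_arc_with_sparse_neighbourhoods:
  fixes L :: real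
  defines "n \<equiv> real (card (pverts G))" and "e \<equiv> real (card (parcs G))"
    and "t \<equiv> real (card (ordered_triangles G))"
  assumes "n > 0" "L \<ge> 0" and many: "2 * n * t < L * (e - (n * e - 2 * e\<^sup>2 / n + t))"
  obtains u v where "(u, v) \<in> parcs G" "pverts G \<subseteq> nbrs G u \<union> nbrs G v"
    and "real (card (arcs_within (nbrs G u)) + card (arcs_within (nbrs G v))) < L"
proof -
  define E0 where "E0 = {p \<in> parcs G. missed p = {}}"
  have fin: "finite E0" using finite_parcs by (simp add: E0_def)
  have fin_missed: "finite (missed p)" for p
    using pair_finite_verts by (simp add: missed_def case_prod_unfold)
  have "e - real (card E0) = real (card (parcs G - E0))"
    unfolding e_def using fin finite_parcs
    by (subst card_Diff_subset) (auto simp: E0_def intro!: of_nat_diff[symmetric] card_mono)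
  also have "\<dots> = (\<Sum>p\<in>parcs G - E0. 1)" by simp
  also have "\<dots> \<le> (\<Sum>p\<in>parcs G - E0. real (card (missed p)))"
    using fin_missed by (intro sum_mono) (auto simp: E0_def Suc_le_eq card_gt_0_iff)
  also have "\<dots> \<le> (\<Sum>p\<in>parcs G. real (card (missed p)))"
    using finite_parcs by (intro sum_mono2) auto
  also have "\<dots> \<le> n * e - 2 * e\<^sup>2 / n + t"
  proof -
    have "e\<^sup>2 / n \<le> (\<Sum>u\<in>pverts G. (real (card (nbrs G u)))\<^sup>2)"
      using card_parcs_squared_le \<open>n > 0\<close> by (simp add: n_def e_def field_simps)
    then show ?thesis by (simp add: sum_missed n_def e_def t_def)
  qed
  finally have E0: "e - (n * e - 2 * e\<^sup>2 / n + t) \<le> real (card E0)" by simp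
  have "\<exists>(u, v)\<in>E0. real (card (arcs_within (nbrs G u)) + card (arcs_within (nbrs G v))) < L"
  proof (rule ccontr)
    assume "\<not> ?thesis"
    then have "(\<Sum>p\<in>E0. L)
        \<le> (\<Sum>(u, v)\<in>E0. real (card (arcs_within (nbrs G u)) + card (arcs_within (nbrs G v))))"
      by (intro sum_mono) (auto simp: not_less)
    then have "L * real (card E0)
        \<le> (\<Sum>(u, v)\<in>E0. real (card (arcs_within (nbrs G u)) + card (arcs_within (nbrs G v))))"
      by (simp add: mult.commute)
    also have "\<dots> \<le> (\<Sum>(u, v)\<in>parcs G. real (card (arcs_within (nbrs G u)) + card (arcs_within (nbrs G v))))"
      using finite_parcs by (intro sum_mono2) (auto simp: E0_def)
    also have "\<dots> \<le> 2 * n * t"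
      unfolding n_def t_def by (rule sum_arcs_within_endpoints_le)
    finally show False
      using many mult_left_mono[OF E0 \<open>L \<ge> 0\<close>] by linarith
  qed
  then show ?thesis using that unfolding E0_def missed_def by blast
qed

section \<open>Triangles across a bipartition\<close>

definition inner_edges :: "'a set \<Rightarrow> 'a set set" where
  "inner_edges A = {{x, y} | x y. (x, y) \<in> parcs G \<and> (x \<in> A \<longleftrightarrow> y \<in> A)}"

lemma finite_inner_edges: "finite (inner_edges A)"
  using pair_finite_verts parcs_subset
  by (intro finite_subset[of "inner_edges A" "Pow (pverts G)"]) (auto simp: inner_edges_def)

lemma inner_edgeE:
  assumes "p \<in> inner_edges A"
  obtains x y where "p = {x, y}" "x \<noteq> y" "(x, y) \<in> parcs G" "x \<in> A \<longleftrightarrow> y \<in> A"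
proof -
  obtain x y where xy: "p = {x, y}" "(x, y) \<in> parcs G" "x \<in> A \<longleftrightarrow> y \<in> A"
    using assms by (auto simp: inner_edges_def)
  moreover have "x \<noteq> y" using xy(2) parcs_irrefl[of x] by auto
  ultimately show thesis using that by blast
qed

lemma inner_edge_subset: "p \<in> inner_edges A \<Longrightarrow> p \<subseteq> pverts G"
  using parcs_subset by (auto simp: inner_edges_def)

lemma card_inner_arcs:
  "card {(x, y) \<in> parcs G. x \<in> A \<longleftrightarrow> y \<in> A} = 2 * card (inner_edges A)"
proof -
  let ?I = "{(x, y) \<in> parcs G. x \<in> A \<longleftrightarrow> y \<in> A}"
  let ?g = "\<lambda>(x, y). {x, y}"
  have fin: "finite ?I" using finite_parcs by (rule finite_subset[rotated]) auto
  have img: "?g ` ?I = inner_edges A" by (auto simp: inner_edges_def)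
  have "card ?I = (\<Sum>p\<in>inner_edges A. card {q \<in> ?I. ?g q = p})"
    unfolding card_eq_sum img[symmetric] by (rule sum.image_gen[OF fin])
  also have "\<dots> = (\<Sum>p\<in>inner_edges A. 2)"
  proof (intro sum.cong refl)
    fix p assume "p \<in> inner_edges A"
    then obtain x y where xy: "p = {x, y}" "(x, y) \<in> parcs G" "x \<in> A \<longleftrightarrow> y \<in> A"
      by (auto simp: inner_edges_def)
    then have "x \<noteq> y" using parcs_irrefl[of x] by auto
    have "{q \<in> ?I. ?g q = p} = {(x, y), (y, x)}"
    proof (intro equalityI subsetI)
      fix q assume "q \<in> {q \<in> ?I. ?g q = p}"
      then have "{fst q, snd q} = {x, y}" unfolding xy(1) by (simp add: case_prod_unfold)
      then show "q \<in> {(x, y), (y, x)}" unfolding doubleton_eq_iff by (cases q) simp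
    next
      fix q assume "q \<in> {(x, y), (y, x)}"
      moreover have "(y, x) \<in> parcs G" using xy(2) by (rule arcs_symmetric)
      ultimately show "q \<in> {q \<in> ?I. ?g q = p}"
        unfolding xy(1) using xy(2,3) by (elim insertE emptyE) (simp_all add: insert_commute)
    qed
    then show "card {q \<in> ?I. ?g q = p} = 2" using \<open>x \<noteq> y\<close> by simp
  qed
  finally show ?thesis by simp
qed

text \<open>
  Two of the three vertices of a triangle lie on the same side, so picking one end of every inner
  edge meets all triangles.
\<close>
lemma triangle_covering_number_le_inner_edges:
  "triangle_covering_number G \<le> card (inner_edges A)"
proof -
  define S where "S = (\<lambda>p. SOME x. x \<in> p) ` inner_edges A"
  have pick: "(SOME x. x \<in> p) \<in> p" if p: "p \<in> inner_edges A" for p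
  proof -
    obtain x y where "p = {x, y}" using p unfolding inner_edges_def by blast
    then have "x \<in> p" by simp
    then show ?thesis by (rule someI)
  qed
  have "S \<subseteq> pverts G"
    unfolding S_def by (rule image_subsetI) (rule subsetD[OF inner_edge_subset pick])
  moreover have "S \<inter> T \<noteq> {}" if T: "T \<in> triangles G" for T
  proof -
    obtain u v w where uvw: "T = {u, v, w}"
      "(u, v) \<in> parcs G" "(v, w) \<in> parcs G" "(u, w) \<in> parcs G"
      using T by (auto simp: triangles_def)
    have inner: "{x, y} \<in> inner_edges A" if "(x, y) \<in> parcs G" "x \<in> A \<longleftrightarrow> y \<in> A" for x y
      unfolding inner_edges_def using that by blast
    have "(u \<in> A \<longleftrightarrow> v \<in> A) \<or> (v \<in> A \<longleftrightarrow> w \<in> A) \<or> (u \<in> A \<longleftrightarrow> w \<in> A)" by blast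
    then obtain p where p: "p \<in> inner_edges A" "p \<subseteq> T"
      using inner uvw by (elim disjE) (simp_all, blast+)
    have "(SOME x. x \<in> p) \<in> S" unfolding S_def using p(1) by (rule imageI)
    moreover have "(SOME x. x \<in> p) \<in> T" using pick[OF p(1)] p(2) by (rule subsetD[rotated])
    ultimately show ?thesis by blast
  qed
  ultimately have "card S \<in> card ` {S. S \<subseteq> pverts G \<and> (\<forall>T \<in> triangles G. S \<inter> T \<noteq> {})}"
    by blast
  moreover have "finite {S. S \<subseteq> pverts G \<and> (\<forall>T \<in> triangles G. S \<inter> T \<noteq> {})}"
    using pair_finite_verts by simp
  ultimately have "triangle_covering_number G \<le> card S"
    unfolding triangle_covering_number_def by (intro Min_le finite_imageI)
  also have "\<dots> \<le> card (inner_edges A)"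
    unfolding S_def using finite_inner_edges by (rule card_image_le)
  finally show ?thesis .
qed

definition missing_pairs :: "'a set \<Rightarrow> ('a \<times> 'a) set" where
  "missing_pairs A = A \<times> (pverts G - A) - parcs G"

lemma card_parcs_bipartition:
  assumes "A \<subseteq> pverts G"
  shows "card (parcs G) + 2 * card (missing_pairs A)
       = 2 * card (inner_edges A) + 2 * (card A * card (pverts G - A))"
proof -
  let ?B = "pverts G - A"
  let ?I = "{(x, y) \<in> parcs G. x \<in> A \<longleftrightarrow> y \<in> A}"
  let ?X = "A \<times> ?B \<inter> parcs G" and ?Y = "?B \<times> A \<inter> parcs G"
  have finA: "finite A" using finite_subset[OF assms] pair_finite_verts by blast
  have split: "parcs G = ?I \<union> (?X \<union> ?Y)"
    using parcs_subset by auto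
  have fin: "finite ?I" "finite ?X" "finite ?Y"
    using finite_parcs by (auto intro: finite_subset[of _ "parcs G"])
  have "card (parcs G) = card ?I + card (?X \<union> ?Y)"
    by (subst split, rule card_Un_disjoint) (use fin in auto)
  also have "card (?X \<union> ?Y) = card ?X + card ?Y"
    using fin by (intro card_Un_disjoint) auto
  also have "card ?Y = card ?X"
    by (intro bij_betw_same_card[of prod.swap] bij_betw_byWitness[where f' = prod.swap])
      (auto intro: arcs_symmetric)
  finally have "card (parcs G) = 2 * card (inner_edges A) + 2 * card ?X"
    by (simp add: card_inner_arcs)
  moreover have "card ?X + card (missing_pairs A) = card A * card ?B"
    using card_Int_Diff[of "A \<times> ?B" "parcs G"] finA pair_finite_verts
    by (simp add: missing_pairs_def card_cartesian_product)
  ultimately show ?thesis by simp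
qed

text \<open>
  An inner edge forms a triangle with each vertex of the opposite side, except where one of the two
  crossing pairs is missing. The missing pairs found for different vertices of the opposite side are
  different, so each inner edge loses at most \<open>card (missing_pairs A)\<close> triangles. A triangle obtained
  in this way has exactly one inner edge, hence no triangle is counted twice.
\<close>
lemma triangles_from_inner_edges:
  assumes "A \<subseteq> pverts G"
  shows "card (inner_edges A) * min (card A) (card (pverts G - A))
       \<le> card (triangles G) + card (inner_edges A) * card (missing_pairs A)"
proof -
  let ?B = "pverts G - A"
  have finA: "finite A" using finite_subset[OF assms] pair_finite_verts by blast
  define opp where "opp p = {w \<in> pverts G. \<forall>x\<in>p. (x, w) \<in> parcs G \<and> (x \<in> A \<longleftrightarrow> w \<notin> A)}" for p
  have fin_miss: "finite (missing_pairs A)"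
    using finA pair_finite_verts by (simp add: missing_pairs_def)
  have opp: "min (card A) (card ?B) \<le> card (opp p) + card (missing_pairs A)"
    if "p \<in> inner_edges A" for p
  proof -
    obtain x y where xy: "p = {x, y}" "(x, y) \<in> parcs G" "x \<in> A \<longleftrightarrow> y \<in> A"
      using \<open>p \<in> inner_edges A\<close> by (auto simp: inner_edges_def)
    have V: "x \<in> pverts G" "y \<in> pverts G" using xy parcs_subset by auto
    define C where "C = (if x \<in> A then ?B else A)"
    \<comment> \<open>\<open>h\<close> sends a vertex that completes no triangle to a crossing pair that witnesses the failure.\<close>
    define h where "h w = (let z = if (x, w) \<in> parcs G then y else x in if x \<in> A then (z, w) else (w, z))" for w
    have finC: "finite C" using finA pair_finite_verts by (simp add: C_def)
    have subC: "opp p \<subseteq> C" using assms by (auto simp: opp_def C_def xy(1))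
    have "h ` (C - opp p) \<subseteq> missing_pairs A"
    proof (rule image_subsetI)
      fix w assume "w \<in> C - opp p"
      then show "h w \<in> missing_pairs A"
        using xy(3) V assms parcs_commute[of w x] parcs_commute[of w y]
        by (auto simp: h_def opp_def C_def xy(1) missing_pairs_def Let_def split: if_splits)
    qed
    moreover have "inj_on h (C - opp p)"
      by (auto simp: inj_on_def h_def Let_def split: if_splits)
    ultimately have "card (C - opp p) \<le> card (missing_pairs A)"
      using fin_miss by (metis card_inj_on_le)
    moreover have "card C = card (opp p) + card (C - opp p)"
      using subC finC by (metis card_Diff_subset card_mono finite_subset le_add_diff_inverse)
    moreover have "min (card A) (card ?B) \<le> card C" by (simp add: C_def)
    ultimately show ?thesis by linarith
  qed
  have fin_opp: "finite (opp p)" for p using pair_finite_verts by (simp add: opp_def)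
  let ?Z = "Sigma (inner_edges A) opp"
  have "(\<lambda>(p, w). insert w p) ` ?Z \<subseteq> triangles G"
  proof clarify
    fix p w assume p: "p \<in> inner_edges A" and w: "w \<in> opp p"
    obtain x y where "p = {x, y}" "(x, y) \<in> parcs G"
      using p by (auto simp: inner_edges_def)
    with w have "insert w p = {x, y, w} \<and> (x, y) \<in> parcs G \<and> (y, w) \<in> parcs G \<and> (x, w) \<in> parcs G"
      by (auto simp: opp_def)
    then show "insert w p \<in> triangles G" unfolding triangles_def by blast
  qed
  moreover have "inj_on (\<lambda>(p, w). insert w p) ?Z"
  proof (rule inj_onI, clarify)
    fix p w q z
    assume p: "p \<in> inner_edges A" "w \<in> opp p" and q: "q \<in> inner_edges A" "z \<in> opp q"
      and eq: "insert w p = insert z q"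
    obtain x y where xy: "p = {x, y}" "x \<noteq> y" using p(1) by (rule inner_edgeE)
    obtain x' y' where xy': "q = {x', y'}" "x' \<noteq> y'" using q(1) by (rule inner_edgeE)
    have side: "x \<in> A \<longleftrightarrow> w \<notin> A" "y \<in> A \<longleftrightarrow> w \<notin> A" "x' \<in> A \<longleftrightarrow> z \<notin> A" "y' \<in> A \<longleftrightarrow> z \<notin> A"
      using p(2) q(2) by (auto simp: opp_def xy xy')
    have wz: "w = z"
    proof (rule ccontr)
      assume "w \<noteq> z"
      moreover have "w \<in> insert z q" "z \<in> insert w p" "x \<in> insert z q" "y \<in> insert z q"
        using eq xy(1) by blast+
      ultimately show False using side xy(2) by (auto simp: xy(1) xy'(1))
    qed
    have "w \<notin> p" "z \<notin> q" using side by (auto simp: xy xy')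
    then show "p = q \<and> w = z" using eq wz by (metis insert_ident)
  qed
  ultimately have "card ?Z \<le> card (triangles G)"
    using finite_triangles by (metis card_inj_on_le)
  moreover have "card ?Z = (\<Sum>p\<in>inner_edges A. card (opp p))"
    using finite_inner_edges fin_opp by simp
  moreover have "card (inner_edges A) * min (card A) (card ?B)
      \<le> (\<Sum>p\<in>inner_edges A. card (opp p) + card (missing_pairs A))"
    using sum_mono[OF opp] by simp
  ultimately show ?thesis by (simp add: sum.distrib)
qed

end

section \<open>Numerical estimates\<close>

text \<open>
  With \<open>l\<close> the spectral radius, \<open>e\<close> the number of arcs and \<open>t\<close> the number of ordered triangles, the
  inequality of Bollobas and Nikiforov gives \<open>2 l\<^sup>2 - e < 6 s\<close>, because \<open>l\<close> is at least about \<open>n / 2\<close>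
  and \<open>t\<close> is less than about \<open>3 s n\<close>. As \<open>4 l\<^sup>2 \<ge> n\<^sup>2 - 1\<close>, this bounds \<open>2 e + 12 s\<close> below strictly by
  \<open>n\<^sup>2 - 1\<close>, and integrality removes the error term \<open>1\<close>. For small \<open>s\<close> the later estimates have no room
  for it.
\<close>
lemma edge_bound_arithmetic:
  fixes n s e t :: nat and l :: real
  assumes "s \<ge> 1" "n \<ge> 2" and l: "sqrt (real (n\<^sup>2 - 1) / 4) \<le> l"
    and tri: "2 * l ^ 3 \<le> real t + l * real e"
    and few: "real t < 3 * real s * real n - 30 * (real s)\<^sup>2"
  shows "n\<^sup>2 \<le> 2 * e + 12 * s"
proof -
  have "real (n\<^sup>2 - 1) = (real n)\<^sup>2 - 1" using assms(2) by (subst of_nat_diff) auto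
  then have sq: "sqrt (((real n)\<^sup>2 - 1) / 4) \<le> l" using l by simp
  have n2: "(real n)\<^sup>2 \<ge> 4" using assms(2) power_mono[of 2 "real n" 2] by simp
  have "(sqrt (((real n)\<^sup>2 - 1) / 4))\<^sup>2 \<le> l\<^sup>2" using sq n2 by (intro power_mono) auto
  then have l2: "((real n)\<^sup>2 - 1) / 4 \<le> l\<^sup>2" using n2 by simp
  have "((real n - 1) / 2)\<^sup>2 \<le> ((real n)\<^sup>2 - 1) / 4"
    using assms(2) by (simp add: power2_eq_square field_simps)
  then have "(real n - 1) / 2 \<le> sqrt (((real n)\<^sup>2 - 1) / 4)" by (rule real_le_rsqrt)
  then have l1: "(real n - 1) / 2 \<le> l" using sq by linarith
  have l0: "l > 0" using l1 assms(2) by simp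
  have "2 * l\<^sup>2 - real e < 6 * real s"
  proof (rule ccontr)
    assume "\<not> ?thesis"
    then have "6 * real s * ((real n - 1) / 2) \<le> (2 * l\<^sup>2 - real e) * l"
      using l1 assms(2) by (intro mult_mono) auto
    also have "\<dots> \<le> real t" using tri by (simp add: algebra_simps power2_eq_square power3_eq_cube)
    also have "\<dots> < 3 * real s * real n - 30 * (real s)\<^sup>2" by (rule few)
    finally have "30 * (real s)\<^sup>2 < 3 * real s" by (simp add: field_simps)
    moreover have "real s \<le> (real s)\<^sup>2" using assms(1) by (simp add: power2_eq_square)
    ultimately show False using assms(1) by linarith
  qed
  then have "(real n)\<^sup>2 < 2 * real e + 12 * real s + 1" using l2 by (simp add: field_simps)
  then have "real (n\<^sup>2) < real (2 * e + 12 * s + 1)" by simp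
  then show ?thesis unfolding of_nat_less_iff by simp
qed

text \<open>
  The averaging condition at \<open>L = n - 8 s - 1/2\<close>, the bound on twice the number of inner edges
  under which \<open>bipartition_arithmetic\<close> applies. Both sides are bounded by cubic forms in \<open>n\<close> and \<open>s\<close>; writing
  \<open>n = 28 s + p\<close> turns their difference into a polynomial with nonnegative coefficients.
\<close>
lemma sparse_arc_arithmetic:
  fixes n s e t :: real
  assumes "s \<ge> 1" "n \<ge> 28 * s" "t < 3 * s * n - 30 * s\<^sup>2" "n\<^sup>2 \<le> 2 * e + 12 * s"
  shows "2 * n * t < (n - 8 * s - 1 / 2) * (e - (n * e - 2 * e\<^sup>2 / n + t))"
proof -
  have n0: "n > 0" using assms by linarith
  define r where "r = 1 - 12 * s / n"
  have r: "0 \<le> r" using assms n0 by (simp add: r_def field_simps)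
  have "n \<le> (2 * e + 12 * s) / n" using assms(4) n0 by (simp add: le_divide_eq power2_eq_square)
  then have "r \<le> 1 - n + 2 * e / n" by (simp add: r_def add_divide_distrib)
  moreover have e0: "(n\<^sup>2 - 12 * s) / 2 \<le> e" using assms(4) by simp
  moreover have "0 \<le> n\<^sup>2 - 12 * s"
    using assms mult_mono[of 28 n "s" n] by (simp add: power2_eq_square)
  ultimately have "(n\<^sup>2 - 12 * s) / 2 * r \<le> e * (1 - n + 2 * e / n)"
    using r by (intro mult_mono) auto
  moreover have "n\<^sup>2 / 2 - 6 * s * n - 6 * s\<^sup>2 \<le> (n\<^sup>2 - 12 * s) / 2 * r"
  proof -
    have "(n\<^sup>2 - 12 * s) / 2 * r = n\<^sup>2 / 2 - 6 * s * n - 6 * s + 72 * s\<^sup>2 / n"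
      using n0 by (simp add: r_def field_simps power2_eq_square)
    moreover have "s \<le> s\<^sup>2" using assms(1) by (simp add: power2_eq_square)
    moreover have "0 \<le> 72 * s\<^sup>2 / n" using n0 by simp
    ultimately show ?thesis by linarith
  qed
  moreover have "e * (1 - n + 2 * e / n) = e - (n * e - 2 * e\<^sup>2 / n)"
    by (simp add: algebra_simps power2_eq_square)
  ultimately have "n\<^sup>2 / 2 - 9 * s * n + 24 * s\<^sup>2 \<le> e - (n * e - 2 * e\<^sup>2 / n + t)"
    using assms(3) by linarith
  moreover have "n - 8.5 * s \<le> n - 8 * s - 1 / 2" using assms(1) by simp
  moreover have "0 \<le> n\<^sup>2 / 2 - 9 * s * n + 24 * s\<^sup>2"
  proof -
    have "28 * s * n \<le> n * n" using assms n0 by (intro mult_right_mono) auto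
    moreover have "s * n \<ge> 0" using assms n0 by simp
    ultimately show ?thesis by (simp add: power2_eq_square)
  qed
  ultimately have "(n - 8.5 * s) * (n\<^sup>2 / 2 - 9 * s * n + 24 * s\<^sup>2)
      \<le> (n - 8 * s - 1 / 2) * (e - (n * e - 2 * e\<^sup>2 / n + t))"
    using assms by (intro mult_mono) auto
  moreover have "2 * n * (3 * s * n - 30 * s\<^sup>2) \<le> (n - 8.5 * s) * (n\<^sup>2 / 2 - 9 * s * n + 24 * s\<^sup>2)"
  proof -
    define p where "p = n - 28 * s"
    have p: "p \<ge> 0" "n = 28 * s + p" using assms by (simp_all add: p_def)
    have "(n - 8.5 * s) * (n\<^sup>2 / 2 - 9 * s * n + 24 * s\<^sup>2) - 2 * n * (3 * s * n - 30 * s\<^sup>2)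
        = 174 * s ^ 3 + 1 / 2 * p ^ 3 + 22.75 * s * p\<^sup>2 + 258.5 * s\<^sup>2 * p"
      unfolding p(2) by (simp add: algebra_simps power2_eq_square power3_eq_cube)
    also have "\<dots> \<ge> 0" using p assms(1) by simp
    finally show ?thesis by simp
  qed
  moreover have "2 * n * t < 2 * n * (3 * s * n - 30 * s\<^sup>2)" using assms(3) n0 by simp
  ultimately show ?thesis by linarith
qed

text \<open>
  Here \<open>a\<close> and \<open>b\<close> are the sizes of the sides, \<open>k\<close> counts the inner edges and \<open>m\<close> the missing crossing
  pairs. An imbalance \<open>d\<close> of the sides lowers the smaller side by \<open>d\<close> but also the number of missing
  pairs by \<open>d\<^sup>2\<close>, so it costs at most \<open>1/4\<close>. This leaves \<open>k (n/2 - 3 s - k - 1/4)\<close> triangles, a concave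
  function of \<open>k\<close> which at both ends of the range from \<open>s\<close> to \<open>n/2 - 4 s - 1/4\<close> equals
  \<open>s (n/2 - 4 s - 1/4)\<close>.
\<close>
lemma bipartition_arithmetic:
  fixes n s k a b e m t :: real
  assumes "s \<ge> 1" "s \<le> k" "2 * k < n - 8 * s - 1 / 2" "a + b = n" "n\<^sup>2 \<le> 2 * e + 12 * s"
    and "e + 2 * m = 2 * k + 2 * (a * b)" "k * min a b \<le> t + k * m"
  shows "s * n / 2 - 5 * s\<^sup>2 \<le> t"
proof -
  define d where "d = \<bar>a - b\<bar> / 2"
  have min: "min a b = n / 2 - d" using assms(4) by (auto simp: d_def min_def abs_if field_simps)
  have "a * b = n\<^sup>2 / 4 - d\<^sup>2"
    unfolding assms(4)[symmetric] by (simp add: d_def power2_eq_square field_simps abs_if)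
  then have "m \<le> k + 3 * s - d\<^sup>2" using assms(5,6) by linarith
  moreover have "d - d\<^sup>2 \<le> 1 / 4"
    using zero_le_power2[of "d - 1 / 2"] by (simp add: power2_eq_square algebra_simps)
  ultimately have "n / 2 - 3 * s - k - 1 / 4 \<le> min a b - m" using min by linarith
  then have "k * (n / 2 - 3 * s - k - 1 / 4) \<le> k * (min a b - m)"
    using assms(1,2) by (intro mult_left_mono) auto
  also have "\<dots> \<le> t" using assms(7) by (simp add: algebra_simps)
  finally have "k * (n / 2 - 3 * s - k - 1 / 4) \<le> t" .
  moreover have "k * (n / 2 - 3 * s - k - 1 / 4)
      = s * n / 2 - 4 * s\<^sup>2 - s / 4 + (k - s) * (n / 2 - 4 * s - 1 / 4 - k)"
    by (simp add: field_simps power2_eq_square)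
  moreover have "0 \<le> (k - s) * (n / 2 - 4 * s - 1 / 4 - k)"
    using assms(2,3) by (intro mult_nonneg_nonneg) auto
  moreover have "s \<le> s\<^sup>2" using assms(1) by (simp add: power2_eq_square)
  ultimately show ?thesis using assms(1) by linarith
qed

section \<open>Counting triangles by the covering number\<close>

theorem theorem2p5:
  fixes G :: "'a pair_pre_digraph" and n s :: nat
  assumes "s \<ge> 1"
    and "pair_graph G"
    and "card (pverts G) = n"
    and "n \<ge> 28 * s^2"
    and "graph_spectral_radius G \<ge> graph_spectral_radius (bipartite_turan n)"
    and "triangle_covering_number G \<ge> s"
  shows "real (card (triangles G)) \<ge> 1/2 * real s * real n - 5 * (real s)^2"
proof (rule ccontr)
  interpret pair_graph G by fact
  let ?W = "card (ordered_triangles G)" and ?e = "card (parcs G)"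
  assume "\<not> ?thesis"
  then have few: "real (card (triangles G)) < 1/2 * real s * real n - 5 * (real s)\<^sup>2" by simp
  have "s \<le> s\<^sup>2" using assms(1) by (simp add: power2_eq_square)
  then have n28: "n \<ge> 28 * s" using assms(4) by linarith
  then have n: "n \<ge> 2" "pverts G \<noteq> {}" using assms(1,3) by auto
  have W: "real ?W < 3 * real s * real n - 30 * (real s)\<^sup>2"
    using few of_nat_mono[OF card_ordered_triangles_le, where 'a=real] by simp
  have "n\<^sup>2 \<le> 2 * ?e + 12 * s"
    using edge_bound_arithmetic[OF assms(1) n(1) _ spectral_radius_triangle_inequality[OF n(2)] W]
      order_trans[OF bipartite_turan_spectral_radius[OF n(1)] assms(5)] by blast
  then have "real (n\<^sup>2) \<le> real (2 * ?e + 12 * s)" by (rule of_nat_mono)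
  then have e: "(real n)\<^sup>2 \<le> 2 * real ?e + 12 * real s" by simp
  have s1: "real s \<ge> 1" and n28': "real n \<ge> 28 * real s" using assms(1) n28 by linarith+
  have "2 * real n * real ?W
      < (real n - 8 * real s - 1 / 2) * (real ?e - (real n * real ?e - 2 * (real ?e)\<^sup>2 / real n + real ?W))"
    by (rule sparse_arc_arithmetic[OF s1 n28' W e])
  moreover have "real n - 8 * real s - 1 / 2 \<ge> 0" using s1 n28' by linarith
  moreover have "real n > 0" using n(1) by simp
  ultimately obtain u v where arc: "(u, v) \<in> parcs G"
    and uv: "pverts G \<subseteq> nbrs G u \<union> nbrs G v"
    "real (card (arcs_within (nbrs G u)) + card (arcs_within (nbrs G v))) < real n - 8 * real s - 1 / 2"
    using spanning_arc_with_sparse_neighbourhoods[of "real n - 8 * real s - 1 / 2", unfolded assms(3)]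
    by metis
  \<comment> \<open>The complement of \<open>A\<close> lies in the neighbourhood of \<open>v\<close>, so both sides are sparse.\<close>
  define A where "A = nbrs G u"
  have "card {(x, y) \<in> parcs G. x \<in> A \<longleftrightarrow> y \<in> A} \<le> card (arcs_within (nbrs G u) \<union> arcs_within (nbrs G v))"
    using uv(1) parcs_subset
    by (intro card_mono finite_UnI finite_arcs_within) (auto simp: A_def arcs_within_def)
  also have "\<dots> \<le> card (arcs_within (nbrs G u)) + card (arcs_within (nbrs G v))"
    by (rule card_Un_le)
  finally have k: "2 * real (card (inner_edges A)) < real n - 8 * real s - 1 / 2"
    using uv(2) unfolding card_inner_arcs by linarith
  have A: "A \<subseteq> pverts G" unfolding A_def by (rule nbrs_subset)
  have ab: "real (card A) + real (card (pverts G - A)) = real n"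
    using A pair_finite_verts assms(3) card_mono[OF _ A]
    by (simp add: card_Diff_subset finite_subset of_nat_diff)
  have "real s * real n / 2 - 5 * (real s)\<^sup>2 \<le> real (card (triangles G))"
  proof (rule bipartition_arithmetic[OF s1 _ k ab e])
    show "real s \<le> real (card (inner_edges A))"
      using assms(6) triangle_covering_number_le_inner_edges[of A] by linarith
    show "real ?e + 2 * real (card (missing_pairs A))
        = 2 * real (card (inner_edges A)) + 2 * (real (card A) * real (card (pverts G - A)))"
      using arg_cong[OF card_parcs_bipartition[OF A], of real] by simp
    show "real (card (inner_edges A)) * min (real (card A)) (real (card (pverts G - A)))
        \<le> real (card (triangles G)) + real (card (inner_edges A)) * real (card (missing_pairs A))"
      using of_nat_mono[OF triangles_from_inner_edges[OF A], where 'a=real]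
      by (simp add: of_nat_min)
  qed
  then show False using few by simp
qed

end
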